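(* Let $X$ be a real normed space and let $K\subset X$ be a convex body. Then for all $\mathbf{x},\mathbf{y}\in X$, $$\big|\alpha(K,\mathbf{x})-\alpha(K,\mathbf{y})\big|\le\frac{2}{w(K)}\|\mathbf{x}-\mathbf{y}\|.$$
   Context: $X$ is a real normed space, $X\neq\{0\}$; $X^*$ is its dual and $S^*$ the unit sphere of $X^*$. A convex body is a bounded, closed, convex set with nonempty interior. The support function of $K$ is $h(K,\mathbf{v}^* )=\sup_{\mathbf{x}\in K}\langle \mathbf{v}^*,\mathbf{x}\rangle$; the width of $K$ in direction $\mathbf{v}^*$ is $w(K,\mathbf{v}^* )=h(K,\mathbf{v}^* )+h(K,-\mathbf{v}^* )$, and the width of $K$ is $w(K)=\inf_{\mathbf{v}^*\in S^*}w(K,\mathbf{v}^* )$. For $\lambda\ge 0$ and $\mathbf{v}^*\in S^*$, with $r=-h(K,-\mathbf{v}^* )$ and $s=h(K,\mathbf{v}^* )$, set $$L^\lambda(K,\mathbf{v}^* )=\left\{\mathbf{x}\in X:\ \tfrac{\lambda+1}{2}r-\tfrac{\lambda-1}{2}s\le\langle\mathbf{v}^*,\mathbf{x}\rangle\le\tfrac{\lambda+1}{2}s-\tfrac{\lambda-1}{2}r\right\},\qquad K^\lambda=\bigcap_{\mathbf{v}^*\in S^*}L^\lambda(K,\mathbf{v}^* ).$$ The generalized Minkowski functional is $\alpha(K,\mathbf{x})=\inf\{\lambda\ge0:\mathbf{x}\in K^\lambda\}$, which is finite for every $\mathbf{x}\in X$. *)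

theory Defs
  imports "HOL-Analysis.Analysis"
begin

definition convex_body :: "'a::real_normed_vector set \<Rightarrow> bool" where
  "convex_body K \<longleftrightarrow> bounded K \<and> closed K \<and> convex K \<and> interior K \<noteq> {}"

text \<open>
  The dual space is the type of bounded linear functionals with the operator norm, so that its
  unit sphere is \<^term>\<open>sphere 0 1\<close>. Suprema and infima are taken in the reals. They are
  suprema and infima of nonempty sets bounded on the relevant side whenever \<open>K\<close> is a convex body
  in a nonzero space.
\<close>

abbreviation dual_sphere :: "('a::real_normed_vector \<Rightarrow>\<^sub>L real) set" where
  "dual_sphere \<equiv> sphere 0 1"

definition support_fun :: "'a::real_normed_vector set \<Rightarrow> ('a \<Rightarrow>\<^sub>L real) \<Rightarrow> real" where
  "support_fun K v = (SUP x\<in>K. blinfun_apply v x)"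

definition dir_width :: "'a::real_normed_vector set \<Rightarrow> ('a \<Rightarrow>\<^sub>L real) \<Rightarrow> real" where
  "dir_width K v = support_fun K v + support_fun K (- v)"

definition width :: "'a::real_normed_vector set \<Rightarrow> real" where
  "width K = (INF v\<in>dual_sphere. dir_width K v)"

definition layer :: "real \<Rightarrow> 'a::real_normed_vector set \<Rightarrow> ('a \<Rightarrow>\<^sub>L real) \<Rightarrow> 'a set" where
  "layer l K v =
    (let r = - support_fun K (- v); s = support_fun K v
     in {x. (l + 1) / 2 * r - (l - 1) / 2 * s \<le> blinfun_apply v x \<and>
            blinfun_apply v x \<le> (l + 1) / 2 * s - (l - 1) / 2 * r})"

definition layer_body :: "real \<Rightarrow> 'a::real_normed_vector set \<Rightarrow> 'a set" where
  "layer_body l K = (\<Inter>v\<in>dual_sphere. layer l K v)"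

definition gen_minkowski :: "'a::real_normed_vector set \<Rightarrow> 'a \<Rightarrow> real" where
  "gen_minkowski K x = Inf {l. 0 \<le> l \<and> x \<in> layer_body l K}"

end

theory Submission
  imports Defs
begin

text \<open>
  Enlarging \<open>\<lambda>\<close> by \<open>\<delta>\<close> moves each of the two hyperplanes bounding
  \<open>L\<^sup>\<lambda>(K, v)\<close> outwards by \<open>\<delta>/2\<close> times the directional width of \<open>K\<close>, hence
  by at least \<open>\<delta> w(K) / 2\<close>. A unit functional changes by at most \<open>\<parallel>x - y\<parallel>\<close> between \<open>x\<close> and
  \<open>y\<close>, so \<open>\<delta> = 2 \<parallel>x - y\<parallel> / w(K)\<close> is enough for \<open>y \<in> K\<^sup>\<lambda>\<close> to imply
  \<open>x \<in> K\<^bsup>\<lambda> + \<delta>\<^esup>\<close> (lemma \<open>layer_body_shift\<close>). Taking infima gives one half of the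
  inequality, and symmetry gives the other. The infima are over nonempty sets: \<open>K \<subseteq> K\<^sup>1\<close>, and the
  shift property then reaches every other point of the space.

  All this presupposes \<open>w(K) > 0\<close>. A ball of radius \<open>\<rho>\<close> inside \<open>K\<close> forces every directional width to
  be at least \<open>2\<rho>\<close>, but the infimum defining \<open>w(K)\<close> is meaningful only if unit functionals exist.
  This is the Hahn--Banach theorem, proved below by minimality: among the sublinear functionals
  below a given one there is a minimal one by Zorn's lemma, and minimal sublinear functionals are
  linear (lemma \<open>minimal_sublinear_linear\<close>).
\<close>

section \<open>Sublinear functionals and the Hahn--Banach theorem\<close>

text \<open>
  Only one inequality of positive homogeneity is demanded, and only for positive factors: this form
  passes directly to infima, and equality for all nonnegative factors follows.
\<close>

definition sublinear :: "('a::real_vector \<Rightarrow> real) \<Rightarrow> bool" where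
  "sublinear p \<longleftrightarrow>
    (\<forall>x y. p (x + y) \<le> p x + p y) \<and> (\<forall>c>0. \<forall>x. p (c *\<^sub>R x) \<le> c * p x)"

lemma sublinear_add: "sublinear p \<Longrightarrow> p (x + y) \<le> p x + p y"
  by (simp add: sublinear_def)

lemma sublinear_zero:
  assumes "sublinear p"
  shows "p 0 = 0"
proof -
  have "p 0 \<le> (1/2) * p 0"
    using assms unfolding sublinear_def by (metis half_gt_zero_iff scaleR_zero_right zero_less_one)
  moreover have "p 0 \<le> p 0 + p 0"
    using sublinear_add[OF assms, of 0 0] by simp
  ultimately show ?thesis by simp
qed

lemma sublinear_scaleR:
  assumes p: "sublinear p" and "c \<ge> 0"
  shows "p (c *\<^sub>R x) = c * p x"
proof (cases "c = 0")
  case True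
  then show ?thesis using sublinear_zero[OF p] by simp
next
  case False
  with \<open>c \<ge> 0\<close> have c: "c > 0" by simp
  have le: "p (d *\<^sub>R z) \<le> d * p z" if "d > 0" for d z
    using p that by (simp add: sublinear_def)
  have "p x \<le> inverse c * p (c *\<^sub>R x)"
    using le[of "inverse c" "c *\<^sub>R x"] c by simp
  then have "c * p x \<le> p (c *\<^sub>R x)"
    using c by (simp add: field_simps)
  with le[OF c, of x] show ?thesis by simp
qed

lemma sublinear_ge: "sublinear p \<Longrightarrow> - p (- x) \<le> p x"
  using sublinear_add[of p x "- x"] sublinear_zero[of p] by simp

lemma sublinear_norm: "sublinear norm"
  by (auto simp: sublinear_def norm_triangle_ineq)

text \<open>
  A sublinear functional can be lowered so that its value at \<open>- y\<close> becomes the least one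
  that \<open>p y\<close> permits, namely \<open>- p y\<close>. The witness is
  \<open>r x = (INF t\<ge>0. p (x + t y) - t p y)\<close>, whose terms for \<open>t = 0\<close> and \<open>t = 1\<close> give the
  two bounds.
\<close>

lemma sublinear_lower:
  fixes p :: "'a::real_vector \<Rightarrow> real"
  assumes p: "sublinear p"
  obtains r where "sublinear r" "\<And>x. r x \<le> p x" "\<And>x. r x \<le> p (x + y) - p y"
proof -
  define g where "g x t = p (x + t *\<^sub>R y) - t * p y" for x t
  define r where "r x = (INF t\<in>{0..}. g x t)" for x
  have lb: "- p (- x) \<le> g x t" if "t \<ge> 0" for x t
    using sublinear_add[OF p, of "x + t *\<^sub>R y" "- x"] sublinear_scaleR[OF p that, of y]
    by (simp add: g_def)
  have bdd: "bdd_below (g x ` {0..})" for x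
    using lb by (intro bdd_belowI2[where m = "- p (- x)"]) auto
  have r_le: "r x \<le> g x t" if "t \<ge> 0" for x t
    unfolding r_def using bdd that by (intro cINF_lower) auto
  have r_ge: "m \<le> r x" if "\<And>t. t \<ge> 0 \<Longrightarrow> m \<le> g x t" for m x
    unfolding r_def using that by (intro cINF_greatest) auto
  have "sublinear r"
    unfolding sublinear_def
  proof (intro conjI allI impI)
    fix x z
    have "r (x + z) \<le> g x t + g z s" if "t \<ge> 0" "s \<ge> 0" for t s
    proof -
      have "r (x + z) \<le> g (x + z) (t + s)" using that by (intro r_le) auto
      also have "\<dots> \<le> g x t + g z s"
        using sublinear_add[OF p, of "x + t *\<^sub>R y" "z + s *\<^sub>R y"]
        by (simp add: g_def algebra_simps)
      finally show ?thesis .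
    qed
    then have "r (x + z) - g x t \<le> r z" if "t \<ge> 0" for t
      using that by (intro r_ge) (simp add: algebra_simps)
    then have "r (x + z) - r z \<le> r x"
      by (intro r_ge) (simp add: algebra_simps)
    then show "r (x + z) \<le> r x + r z" by simp
  next
    fix c :: real and x assume c: "c > 0"
    have "r (c *\<^sub>R x) / c \<le> r x"
    proof (rule r_ge)
      fix t :: real assume t: "t \<ge> 0"
      have "r (c *\<^sub>R x) \<le> g (c *\<^sub>R x) (c * t)" using c t by (intro r_le) auto
      also have "\<dots> = c * g x t"
        using sublinear_scaleR[OF p, of c "x + t *\<^sub>R y"] c
        by (simp add: g_def algebra_simps)
      finally show "r (c *\<^sub>R x) / c \<le> g x t"
        using c by (simp add: field_simps)
    qed
    then show "r (c *\<^sub>R x) \<le> c * r x" using c by (simp add: field_simps)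
  qed
  moreover have "r x \<le> p x" for x using r_le[of 0 x] by (simp add: g_def)
  moreover have "r x \<le> p (x + y) - p y" for x using r_le[of 1 x] by (simp add: g_def)
  ultimately show ?thesis by (rule that)
qed

text \<open>
  By minimality, the lowering of the previous lemma in any direction \<open>y\<close> leaves the functional
  unchanged; its second bound then reads as superadditivity.
\<close>

lemma minimal_sublinear_linear:
  fixes f :: "'a::real_vector \<Rightarrow> real"
  assumes f: "sublinear f"
    and minimal: "\<And>q. sublinear q \<Longrightarrow> (\<And>x. q x \<le> f x) \<Longrightarrow> q = f"
  shows "linear f"
proof -
  have add: "f (x + y) = f x + f y" for x y
  proof -
    obtain r where "sublinear r" "\<And>x. r x \<le> f x" and r: "\<And>x. r x \<le> f (x + y) - f y"
      using sublinear_lower[OF f] by blast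
    then have "r = f" by (intro minimal)
    with r[of x] sublinear_add[OF f, of x y] show ?thesis by simp
  qed
  have neg: "f (- x) = - f x" for x
    using add[of x "- x"] sublinear_zero[OF f] by simp
  have "f (c *\<^sub>R x) = c * f x" for c x
  proof (cases "c \<ge> 0")
    case True
    then show ?thesis using sublinear_scaleR[OF f] by simp
  next
    case False
    then show ?thesis using sublinear_scaleR[OF f, of "- c" x] neg[of "c *\<^sub>R x"] by simp
  qed
  with add show ?thesis by (intro linearI) simp_all
qed

text \<open>
  Any two members of a chain have a smaller one, which makes subadditivity pass to the
  infimum. The infimum is finite because \<open>- p (- x)\<close> bounds every member from below.
\<close>

lemma chain_of_sublinear_bounded_below:
  fixes p :: "'a::real_vector \<Rightarrow> real"
  assumes p: "sublinear p"
    and C: "\<And>q. q \<in> C \<Longrightarrow> sublinear q \<and> q \<le> p"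
    and chain: "\<And>q r. q \<in> C \<Longrightarrow> r \<in> C \<Longrightarrow> q \<le> r \<or> r \<le> q"
  shows "\<exists>u. sublinear u \<and> u \<le> p \<and> (\<forall>q\<in>C. u \<le> q)"
proof (cases "C = {}")
  case True
  with p show ?thesis by auto
next
  case False
  define u where "u x = (INF q\<in>C. q x)" for x
  have lb: "- p (- x) \<le> q x" if "q \<in> C" for q x
  proof -
    have "q (- x) \<le> p (- x)" using C[OF that] by (simp add: le_fun_def)
    with sublinear_ge[of q x] C[OF that] show ?thesis by linarith
  qed
  have u_le: "u x \<le> q x" if "q \<in> C" for q x
    unfolding u_def using that lb by (intro cINF_lower bdd_belowI2[where m = "- p (- x)"]) auto
  have u_ge: "m \<le> u x" if "\<And>q. q \<in> C \<Longrightarrow> m \<le> q x" for m x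
    unfolding u_def using that False by (intro cINF_greatest) auto
  have "sublinear u"
    unfolding sublinear_def
  proof (intro conjI allI impI)
    fix x y
    have "u (x + y) \<le> q x + r y" if qr: "q \<in> C" "r \<in> C" for q r
    proof -
      obtain s where s: "s \<in> C" "s \<le> q" "s \<le> r"
        using chain[OF qr] qr by blast
      have "u (x + y) \<le> s (x + y)" using s(1) by (rule u_le)
      also have "\<dots> \<le> s x + s y" using C[OF s(1)] by (simp add: sublinear_add)
      also have "\<dots> \<le> q x + r y" using s(2,3) by (simp add: le_fun_def add_mono)
      finally show ?thesis .
    qed
    then have "u (x + y) - r y \<le> u x" if "r \<in> C" for r
      using that by (intro u_ge) (simp add: diff_le_eq)
    then have "u (x + y) - u x \<le> u y"
      by (intro u_ge) (simp add: diff_le_eq le_diff_eq add.commute)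
    then show "u (x + y) \<le> u x + u y" by simp
  next
    fix c :: real and x assume c: "c > 0"
    have "u (c *\<^sub>R x) / c \<le> u x"
    proof (rule u_ge)
      fix q assume q: "q \<in> C"
      have "u (c *\<^sub>R x) \<le> c * q x"
        using u_le[OF q, of "c *\<^sub>R x"] C[OF q] sublinear_scaleR[of q c x] c by simp
      then show "u (c *\<^sub>R x) / c \<le> q x" using c by (simp add: field_simps)
    qed
    then show "u (c *\<^sub>R x) \<le> c * u x" using c by (simp add: field_simps)
  qed
  moreover have "u \<le> p"
    using False u_le C by (fastforce simp: le_fun_def intro: order_trans)
  moreover have "\<forall>q\<in>C. u \<le> q" using u_le by (simp add: le_fun_def)
  ultimately show ?thesis by blast
qed

lemma linear_below_sublinear:
  fixes p :: "'a::real_vector \<Rightarrow> real"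
  assumes p: "sublinear p"
  obtains f where "linear f" "\<And>x. f x \<le> p x"
proof -
  define A where "A = {q. sublinear q \<and> q \<le> p}"
  define P where "P q r \<longleftrightarrow> r \<le> q" for q r :: "'a \<Rightarrow> real"
  have "\<exists>m\<in>A. \<forall>q\<in>A. P m q \<longrightarrow> q = m"
  proof (rule predicate_Zorn)
    show "partial_order_on A (relation_of P A)"
      by (rule partial_order_on_relation_ofI) (auto simp: P_def)
    fix C assume C: "C \<in> Chains (relation_of P A)"
    then have "C \<subseteq> A" by (rule Chains_relation_of)
    moreover have "q \<le> r \<or> r \<le> q" if "q \<in> C" "r \<in> C" for q r
      using C that by (auto simp: Chains_def relation_of_def P_def)
    ultimately show "\<exists>u\<in>A. \<forall>q\<in>C. P q u"
      using chain_of_sublinear_bounded_below[OF p, of C] by (auto simp: A_def P_def)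
  qed
  then obtain m where m: "m \<in> A" and "\<And>q. q \<in> A \<Longrightarrow> q \<le> m \<Longrightarrow> q = m"
    by (auto simp: P_def)
  then have "linear m"
    by (intro minimal_sublinear_linear) (auto simp: A_def le_fun_def intro: order_trans)
  moreover have "m x \<le> p x" for x using m by (simp add: A_def le_fun_def)
  ultimately show ?thesis by (rule that)
qed

text \<open>
  Lowering the norm in the direction of a nonzero vector \<open>z\<close> before passing to a linear functional
  forces the latter to attain the value \<open>\<parallel>z\<parallel>\<close> at \<open>z\<close>, so that its norm is exactly \<open>1\<close>.
\<close>

lemma dual_sphere_nonempty:
  assumes "(UNIV :: 'a::real_normed_vector set) \<noteq> {0}"
  shows "(dual_sphere :: ('a \<Rightarrow>\<^sub>L real) set) \<noteq> {}"
proof -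
  obtain z :: 'a where z: "z \<noteq> 0" using assms by auto
  obtain r :: "'a \<Rightarrow> real" where r: "sublinear r" "\<And>x. r x \<le> norm x"
    "\<And>x. r x \<le> norm (x + z) - norm z"
    using sublinear_lower[OF sublinear_norm] by blast
  obtain f where f: "linear f" "\<And>x. f x \<le> r x"
    using linear_below_sublinear[OF r(1)] by blast
  have le: "f x \<le> norm x" for x
    using f(2)[of x] r(2)[of x] by linarith
  have abs: "norm (f x) \<le> norm x" for x
    using le[of x] le[of "- x"] linear_neg[OF f(1), of x] by simp
  have "bounded_linear f"
    using f(1) abs by (intro bounded_linear_intro[where K = 1])
      (auto simp: linear_add linear_cmul)
  then have app: "blinfun_apply (Blinfun f) = f"
    by (rule bounded_linear_Blinfun_apply)
  have "norm z \<le> f z"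
    using f(2)[of "- z"] r(3)[of "- z"] linear_neg[OF f(1), of z] by simp
  also have "f z \<le> norm (Blinfun f) * norm z"
    using norm_blinfun[of "Blinfun f" z] by (simp add: app)
  finally have "1 \<le> norm (Blinfun f)" using z by simp
  moreover have "norm (Blinfun f) \<le> 1"
    by (rule norm_blinfun_bound) (use abs app in auto)
  ultimately show ?thesis by (auto simp: dist_norm)
qed

section \<open>The width of a convex body\<close>

lemma support_fun_upper:
  assumes "bounded K" "x \<in> K"
  shows "blinfun_apply v x \<le> support_fun K v"
proof -
  have "bounded (blinfun_apply v ` K)"
    using assms(1) blinfun.bounded_linear_right by (rule bounded_linear_image)
  then show ?thesis
    unfolding support_fun_def using assms(2) by (intro cSUP_upper bounded_imp_bdd_above)
qed

lemma support_fun_lower: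
  assumes "bounded K" "x \<in> K"
  shows "- support_fun K (- v) \<le> blinfun_apply v x"
  using support_fun_upper[OF assms, of "- v"] by (simp add: blinfun.minus_left)

text \<open>
  The operator norm is the supremum of \<open>v\<close> over the unit ball, so the support function of a
  ball of radius \<open>\<rho>\<close> exceeds the value of \<open>v\<close> at the centre by \<open>\<rho> \<parallel>v\<parallel>\<close>.
\<close>

lemma support_fun_cball:
  fixes v :: "'a::real_normed_vector \<Rightarrow>\<^sub>L real"
  assumes "bounded K" "cball c \<rho> \<subseteq> K" "\<rho> > 0"
  shows "blinfun_apply v c + \<rho> * norm v \<le> support_fun K v"
proof -
  define M where "M = (support_fun K v - blinfun_apply v c) / \<rho>"
  have up: "blinfun_apply v c + blinfun_apply v u \<le> support_fun K v" if "norm u \<le> \<rho>" for u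
    using support_fun_upper[OF assms(1), of "c + u" v] assms(2) that
    by (auto simp: blinfun.add_right dist_norm subset_iff)
  have M: "blinfun_apply v x \<le> M * norm x" for x
  proof (cases "x = 0")
    case False
    then show ?thesis
      using up[of "(\<rho> / norm x) *\<^sub>R x"] \<open>\<rho> > 0\<close>
      by (simp add: blinfun.scaleR_right M_def field_simps)
  qed simp
  have "norm v \<le> M"
  proof (rule norm_blinfun_bound)
    show "0 \<le> M" using up[of 0] \<open>\<rho> > 0\<close> by (simp add: M_def)
    show "norm (blinfun_apply v x) \<le> M * norm x" for x
      using M[of x] M[of "- x"] by (simp add: blinfun.minus_right abs_le_iff)
  qed
  then show ?thesis using \<open>\<rho> > 0\<close> by (simp add: M_def field_simps)
qed

lemma dir_width_ge_inner_cball: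
  assumes "bounded K" "cball c \<rho> \<subseteq> K" "\<rho> > 0" "v \<in> dual_sphere"
  shows "2 * \<rho> \<le> dir_width K v"
  using support_fun_cball[OF assms(1-3), of v] support_fun_cball[OF assms(1-3), of "- v"] assms(4)
  by (simp add: dir_width_def blinfun.minus_left)

lemma convex_body_width:
  fixes K :: "'a::real_normed_vector set"
  assumes "(UNIV :: 'a set) \<noteq> {0}" and K: "convex_body K"
  shows width_pos: "0 < width K"
    and width_le_dir_width: "v \<in> dual_sphere \<Longrightarrow> width K \<le> dir_width K v"
proof -
  obtain c \<rho> where \<rho>: "\<rho> > 0" "cball c \<rho> \<subseteq> K"
    using K unfolding convex_body_def by (meson ex_in_conv mem_interior_cball)
  have ge: "2 * \<rho> \<le> dir_width K v" if "v \<in> dual_sphere" for v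
    using K \<rho> that by (intro dir_width_ge_inner_cball) (auto simp: convex_body_def)
  have "2 * \<rho> \<le> width K"
    unfolding width_def using dual_sphere_nonempty[OF assms(1)] ge by (intro cINF_greatest) auto
  with \<rho> show "0 < width K" by simp
  show "width K \<le> dir_width K v" if "v \<in> dual_sphere"
    unfolding width_def using that ge by (intro cINF_lower bdd_belowI2[where m = "2 * \<rho>"]) auto
qed

section \<open>The Lipschitz estimate\<close>

text \<open>
  Written with the directional width, the bounds of a layer show how it grows: \<open>\<lambda> = 1\<close> is the
  supporting layer of \<open>K\<close>, and its faces recede at the rate \<open>dir_width K v / 2\<close>.
\<close>

lemma mem_layer_iff:
  "x \<in> layer l K v \<longleftrightarrow>
    - support_fun K (- v) - (l - 1) / 2 * dir_width K v \<le> blinfun_apply v x \<and>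
    blinfun_apply v x \<le> support_fun K v + (l - 1) / 2 * dir_width K v"
proof -
  have "(l + 1) / 2 * - b - (l - 1) / 2 * a = - b - (l - 1) / 2 * (a + b)"
    "(l + 1) / 2 * a - (l - 1) / 2 * - b = a + (l - 1) / 2 * (a + b)" for a b :: real
    by (simp_all add: field_simps)
  then show ?thesis
    by (simp only: layer_def dir_width_def Let_def mem_Collect_eq)
qed

lemma layer_body_shift:
  fixes K :: "'a::real_normed_vector set"
  assumes X: "(UNIV :: 'a set) \<noteq> {0}" and K: "convex_body K" and y: "y \<in> layer_body l K"
  shows "x \<in> layer_body (l + 2 / width K * norm (x - y)) K"
  unfolding layer_body_def
proof
  fix v :: "'a \<Rightarrow>\<^sub>L real" assume v: "v \<in> dual_sphere"
  define d where "d = norm (x - y)"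
  have yv: "y \<in> layer l K v" using y v by (auto simp: layer_body_def)
  have "norm (blinfun_apply v (x - y)) \<le> d"
    using norm_blinfun[of v "x - y"] v by (simp add: d_def)
  then have near: "\<bar>blinfun_apply v x - blinfun_apply v y\<bar> \<le> d"
    by (simp add: blinfun.diff_right)
  have "d * 1 \<le> d * (dir_width K v / width K)"
    using width_pos[OF X K] width_le_dir_width[OF X K v]
    by (intro mult_left_mono) (simp_all add: d_def)
  moreover have "(l + 2 / width K * d - 1) / 2 * dir_width K v
      = (l - 1) / 2 * dir_width K v + d * (dir_width K v / width K)"
    by (simp add: algebra_simps add_divide_distrib diff_divide_distrib)
  ultimately show "x \<in> layer (l + 2 / width K * norm (x - y)) K v"
    using yv near unfolding mem_layer_iff d_def[symmetric] by linarith
qed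

lemma subset_layer_body_1:
  assumes "bounded K"
  shows "K \<subseteq> layer_body 1 K"
  using support_fun_upper[OF assms] support_fun_lower[OF assms]
  by (auto simp: layer_body_def mem_layer_iff)

lemma gen_minkowski_le:
  fixes K :: "'a::real_normed_vector set"
  assumes X: "(UNIV :: 'a set) \<noteq> {0}" and K: "convex_body K"
  shows "gen_minkowski K x \<le> gen_minkowski K y + 2 / width K * norm (x - y)"
proof -
  define S where "S z = {l. 0 \<le> l \<and> z \<in> layer_body l K}" for z
  have shift: "l + 2 / width K * norm (z - z') \<in> S z" if "l \<in> S z'" for l z z'
    using that layer_body_shift[OF X K] width_pos[OF X K] by (simp add: S_def)
  obtain k where "k \<in> K"
    using K interior_subset[of K] by (auto simp: convex_body_def)
  then have "1 \<in> S k"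
    using K subset_layer_body_1[of K] by (auto simp: S_def convex_body_def)
  then have "S y \<noteq> {}" using shift by blast
  moreover have "Inf (S x) - 2 / width K * norm (x - y) \<le> l" if "l \<in> S y" for l
  proof -
    have "bdd_below (S x)" by (rule bdd_belowI[of _ 0]) (simp add: S_def)
    then have "Inf (S x) \<le> l + 2 / width K * norm (x - y)"
      using shift[OF that] by (intro cInf_lower)
    then show ?thesis by simp
  qed
  ultimately have "Inf (S x) - 2 / width K * norm (x - y) \<le> Inf (S y)"
    by (rule cInf_greatest)
  then show ?thesis by (simp add: gen_minkowski_def S_def)
qed

theorem proposition5p3:
  fixes K :: "'a::real_normed_vector set" and x y :: 'a
  assumes "(UNIV :: 'a set) \<noteq> {0}"
    and "convex_body K"
  shows "\<bar>gen_minkowski K x - gen_minkowski K y\<bar> \<le> 2 / width K * norm (x - y)"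
  using gen_minkowski_le[OF assms, of x y] gen_minkowski_le[OF assms, of y x]
  by (simp add: norm_minus_commute abs_le_iff)

end
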